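(* Let $ n, a, a_{1}, \dots , a_{d} \in \mathbb{N} $. If \[ S \left( a; a_{1}, \dots , a_{d} \right) := \sum_{ k \text{ mod } a } f_{1} \left( \frac{k a_{1} }{a } \right) \cdots f_{d} \left( \frac{k a_{d} }{a } \right) \] is of Dedekind type with weight $ \left( m_{1} , \dots , m_{d} \right) $ then \[ \sum_{ b | n } b^{ - m_{1} - \dots - m_{d} } \! \sum_{ r_{1} , \dots , r_{d} \text{ mod } b } \! S \left( ab; \frac{ n }{ b } a_{1} + r_{1} a \ , \ \dots \ , \ \frac{ n }{ b } a_{d} + r_{d} a \right) = \ n \ \sigma_{ d - 1 - m_{1} - \dots - m_{d} } (n) \ S \left( a; a_{1}, \dots , a_{d} \right) \ . \]
   Context: $\mathbb{N}$ denotes the positive integers. For $a, a_1,\dots,a_d \in \mathbb{N}$, a sum $S(a;a_1,\dots,a_d) := \sum_{k \text{ mod } a} f_1\left(\frac{k a_1}{a}\right)\cdots f_d\left(\frac{k a_d}{a}\right)$ is said to be of Dedekind type with weight $(m_1,\dots,m_d)$ if for all $j=1,\dots,d$ the function $f_j$ satisfies $f_j(x+1)=f_j(x)$ and, for all $a\in\mathbb{N}$, $\sum_{k \text{ mod } a} f_j\left(x+\frac{k}{a}\right) = a^{m_j} f_j(ax)$. Also $\sigma_m(n) := \sum_{d|n} d^m$. *)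

theory Defs
  imports "HOL-Analysis.Analysis" "HOL-Library.FuncSet"
begin

text \<open>
  A tuple $(f_1,\dots,f_d)$ or $(a_1,\dots,a_d)$ is a function on \<open>nat\<close>, of which only the values
  on \<open>{1..d}\<close> matter. A sum over \<open>k mod a\<close> is taken over the residues \<open>0, \<dots>, a - 1\<close>; for
  1-periodic \<open>f j\<close> the choice of representatives is irrelevant.
\<close>

definition dedekind_sum ::
  "nat \<Rightarrow> (nat \<Rightarrow> real \<Rightarrow> complex) \<Rightarrow> nat \<Rightarrow> (nat \<Rightarrow> nat) \<Rightarrow> complex" where
  "dedekind_sum d f a as = (\<Sum>k<a. \<Prod>j=1..d. f j (real (k * as j) / real a))"

text \<open>
  Weights may be arbitrary complex numbers; since the bases are positive integers, \<open>powr\<close> is the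
  ordinary power whenever a weight is an integer.
\<close>

definition dedekind_type ::
  "nat \<Rightarrow> (nat \<Rightarrow> real \<Rightarrow> complex) \<Rightarrow> (nat \<Rightarrow> complex) \<Rightarrow> bool" where
  "dedekind_type d f m \<longleftrightarrow> (\<forall>j\<in>{1..d}.
     (\<forall>x. f j (x + 1) = f j x) \<and>
     (\<forall>a>0. \<forall>x. (\<Sum>k<a. f j (x + real k / real a)) = of_nat a powr m j * f j (real a * x)))"

definition divisor_sigma :: "complex \<Rightarrow> nat \<Rightarrow> complex" where
  "divisor_sigma m n = (\<Sum>d | d dvd n. of_nat d powr m)"

end

theory Submission
  imports Defs "HOL-Number_Theory.Cong"
begin

text \<open>
  Summing over \<open>r\<^sub>1, \<dots>, r\<^sub>d\<close> first, each factor becomes a distribution sum over multiples of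
  \<open>k / b\<close>; with \<open>g = gcd k b\<close> it equals \<open>g (b / g)\<^bsup>m\<^esup>\<close> times the value of \<open>f j\<close> at
  \<open>(k / g) (n / b) (as j / a)\<close>. Writing \<open>F t\<close> for the \<open>t\<close>-th summand of
  \<open>S(a; a\<^sub>1, \<dots>, a\<^sub>d)\<close>, the left-hand side is the sum of \<open>g\<close> to the power \<open>d - m\<^sub>1 - \<dots> - m\<^sub>d\<close>
  times \<open>F t\<close>, where \<open>t = (k / g) (n / b)\<close>. The map \<open>(b, k) \<mapsto> (g, t)\<close> is a bijection onto the
  pairs with \<open>g dvd n\<close> and \<open>t < a (n / g)\<close>, and \<open>F\<close> has period \<open>a\<close>.
\<close>

lemma periodic_add_mult:
  fixes h :: "nat \<Rightarrow> 'a"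
  assumes "\<And>i. h (i + p) = h i"
  shows "h (i + q * p) = h i"
proof (induction q)
  case (Suc q)
  then show ?case using assms[of "i + q * p"] by (simp add: algebra_simps)
qed simp

lemma sum_periodic_periods:
  fixes h :: "nat \<Rightarrow> 'a :: comm_semiring_1"
  assumes "\<And>i. h (i + p) = h i"
  shows "(\<Sum>i<q * p. h i) = of_nat q * (\<Sum>i<p. h i)"
proof (induction q)
  case (Suc q)
  \<comment> \<open>\<open>sum.nat_group\<close> cuts both ranges into blocks of length
    \<open>p\<close>; the extra last block is then shifted back to start at 0.\<close>
  have "(\<Sum>i<Suc q * p. h i) = (\<Sum>i<q * p. h i) + (\<Sum>i<p. h (i + q * p))"
    using sum.nat_group[of h p q] sum.nat_group[of h p "Suc q"]
    sum.shift_bounds_nat_ivl[of h 0 "q * p" p] by (simp add: lessThan_atLeast0 add.commute)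
  then show ?case
    by (simp add: Suc periodic_add_mult[of h p, OF assms] distrib_right add.commute)
qed simp

text \<open>Multiplication by a unit \<open>l\<close> permutes the residues modulo \<open>p\<close>,
  and \<open>h\<close> depends only on the residue.\<close>

lemma sum_periodic_coprime_multiples:
  fixes h :: "nat \<Rightarrow> 'a :: comm_semiring_1"
  assumes periodic: "\<And>i. h (i + p) = h i" and "coprime l p" "p > 0"
  shows "(\<Sum>i<p. h (l * i)) = (\<Sum>i<p. h i)"
proof -
  let ?\<pi> = "\<lambda>i. l * i mod p"
  have mod: "h (i mod p) = h i" for i
    using periodic_add_mult[of h p "i mod p" "i div p", OF periodic] by simp
  have "inj_on ?\<pi> {..<p}"
  proof (rule inj_onI)
    fix i j assume "i \<in> {..<p}" "j \<in> {..<p}" "?\<pi> i = ?\<pi> j"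
    then show "i = j"
      using cong_mult_lcancel_nat[OF \<open>coprime l p\<close>, of i j] by (simp add: cong_def)
  qed
  moreover have "?\<pi> ` {..<p} \<subseteq> {..<p}"
    using \<open>p > 0\<close> by auto
  ultimately have "bij_betw ?\<pi> {..<p} {..<p}"
    by (simp add: bij_betw_def endo_inj_surj)
  then have "(\<Sum>i<p. h (?\<pi> i)) = (\<Sum>i<p. h i)"
    by (rule sum.reindex_bij_betw)
  then show ?thesis by (simp add: mod)
qed

text \<open>After cancelling the gcd, \<open>k * r / b\<close> becomes \<open>l * r / c\<close> with
  \<open>l\<close> and \<open>c\<close> coprime, so the sum runs through \<open>gcd k b\<close> full
  periods, each permuted by \<open>l\<close>. The right-hand side has the shape to which the
  distribution relation applies.\<close>

lemma sum_periodic_multiples: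
  fixes f :: "real \<Rightarrow> 'a :: comm_semiring_1"
  assumes periodic: "\<And>x. f (x + 1) = f x" and "b > 0"
  shows "(\<Sum>r<b. f (x + real (k * r) / real b)) =
         of_nat (gcd k b) * (\<Sum>r<b div gcd k b. f (x + real r / real (b div gcd k b)))"
proof -
  define g where "g = gcd k b"
  define c where "c = b div g"
  define l where "l = k div g"
  define h where "h i = f (x + real i / real c)" for i
  have "g > 0" "b = g * c" "k = g * l"
    using \<open>b > 0\<close> by (auto simp: g_def c_def l_def)
  then have "c > 0" using \<open>b > 0\<close> by (auto intro: gr0I)
  have "coprime l c"
    unfolding l_def c_def g_def using \<open>b > 0\<close> by (intro div_gcd_coprime) auto
  have h: "h (i + c) = h i" for i
    using \<open>c > 0\<close> periodic[of "x + real i / real c"] by (simp add: h_def add_divide_distrib add.assoc)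
  have lh: "h (l * (i + c)) = h (l * i)" for i
    using periodic_add_mult[of h c "l * i" l, OF h] by (simp add: algebra_simps)
  have "(\<Sum>r<b. f (x + real (k * r) / real b)) = (\<Sum>r<g * c. h (l * r))"
    unfolding h_def using \<open>g > 0\<close> by (simp add: \<open>b = g * c\<close> \<open>k = g * l\<close>)
  also have "\<dots> = of_nat g * (\<Sum>r<c. h (l * r))"
    by (rule sum_periodic_periods) (rule lh)
  also have "(\<Sum>r<c. h (l * r)) = (\<Sum>r<c. h r)"
    using h \<open>coprime l c\<close> \<open>c > 0\<close> by (rule sum_periodic_coprime_multiples)
  finally show ?thesis by (simp add: h_def c_def g_def)
qed

text \<open>Complex \<open>powr\<close> is not multiplicative in the base in general; for positive
  reals the logarithms add without a branch correction.\<close>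

lemma of_nat_mult_powr:
  assumes "g > 0" "c > 0"
  shows "(of_nat (g * c) :: complex) powr z = of_nat g powr z * of_nat c powr z"
  using powr_times_real[of "of_nat g" "of_nat c" z] by simp

text \<open>The powers of \<open>c\<close> cancel, and each index in \<open>A\<close> leaves one
  factor \<open>g\<close>. Hence the weight of a summand depends on the gcd alone.\<close>

lemma prod_powr_weights:
  fixes m :: "'i \<Rightarrow> complex"
  assumes "finite A" "g > 0" "c > 0"
  shows "of_nat (g * c) powr (- (\<Sum>j\<in>A. m j)) * (\<Prod>j\<in>A. of_nat g * of_nat c powr m j) =
         of_nat g powr (of_nat (card A) - (\<Sum>j\<in>A. m j))"
proof -
  have "(\<Prod>j\<in>A. of_nat c powr m j) = of_nat c powr (\<Sum>j\<in>A. m j)"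
    using \<open>finite A\<close> \<open>c > 0\<close> by (induction rule: finite_induct) (simp_all add: powr_add)
  then show ?thesis
    using assms by (simp add: of_nat_mult_powr prod.distrib powr_minus powr_diff powr_nat'
        field_simps del: of_nat_mult)
qed

text \<open>Write \<open>k = l * g\<close>, \<open>b = c * g\<close> with \<open>l\<close>,
  \<open>c\<close> coprime, and \<open>n = b * e\<close>. Then \<open>t = l * e\<close> and
  \<open>n div g = c * e\<close>, so \<open>e\<close> is the gcd of \<open>t\<close> and
  \<open>n div g\<close>. The roles of \<open>g\<close> and \<open>e\<close> are symmetric, which
  yields the inverse map; both range conditions amount to \<open>l < a * c\<close>.\<close>

lemma sum_gcd_reindex:
  fixes G :: "nat \<Rightarrow> nat \<Rightarrow> 'a :: comm_monoid_add"
  assumes "n > 0"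
  shows "(\<Sum>b | b dvd n. \<Sum>k<a * b. G (gcd k b) (k div gcd k b * (n div b))) =
         (\<Sum>g | g dvd n. \<Sum>t<n div g * a. G g t)"
proof -
  let ?D = "{b. b dvd n}"
  have "finite ?D" using \<open>n > 0\<close> by simp
  \<comment> \<open>Naming \<open>g\<close>, \<open>e\<close> and \<open>t\<close> by equations
    keeps the statement readable; \<open>refl\<close> discharges them when the bijection is
    checked.\<close>
  have fwd: "gcd t (n div g) = e \<and> g dvd n \<and> t < n div g * a \<and> g * (n div g div e) = b \<and> g * (t div e) = k"
    if "b dvd n" "k < a * b" "g = gcd k b" "e = n div b" "t = k div g * e" for b k g e t
  proof -
    have n: "n = b * e" using that by simp
    then have "e > 0" "b > 0" using \<open>n > 0\<close> by auto
    have g: "g = gcd k b" using that by simp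
    then have "g > 0" using \<open>b > 0\<close> by simp
    then obtain l c where lc: "k = l * g" "b = c * g" "coprime l c"
      using gcd_coprime_exists[of k b, folded g] by blast
    then have ng: "n div g = c * e" using \<open>g > 0\<close> by (simp add: n)
    have t: "t = l * e" using \<open>g > 0\<close> by (simp add: that(5) lc(1))
    have "gcd t (n div g) = e"
      using lc(3) by (simp add: t ng gcd_mult_right gcd.commute coprime_iff_gcd_eq_1)
    moreover have "l * g < a * c * g" using \<open>k < a * b\<close> unfolding lc(1,2) by (simp only: mult.assoc)
    then have "l < a * c" by simp
    then have "t < n div g * a" using \<open>e > 0\<close> by (simp add: t ng mult.commute[of _ a] flip: mult.assoc)
    moreover have "g dvd n" by (simp add: n lc(2))
    moreover have "g * (n div g div e) = b" "g * (t div e) = k"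
      using \<open>e > 0\<close> by (simp_all add: ng t lc(1,2))
    ultimately show ?thesis by blast
  qed
  have bwd: "gcd k b = g \<and> b dvd n \<and> k < a * b \<and> k div g * (n div b) = t"
    if "g dvd n" "t < n div g * a" "e = gcd t (n div g)" "b = g * (n div g div e)" "k = g * (t div e)"
    for b k g e t
  proof -
    define N where "N = n div g"
    have n: "n = g * N" using that by (simp add: N_def)
    then have "g > 0" "N > 0" using \<open>n > 0\<close> by auto
    have e: "e = gcd t N" using that by (simp add: N_def)
    then have "e > 0" using \<open>N > 0\<close> by simp
    then obtain l c where lc: "t = l * e" "N = c * e" "coprime l c"
      using gcd_coprime_exists[of t N, folded e] by blast
    then have "c > 0" using \<open>N > 0\<close> by (auto intro: gr0I)
    have b: "b = c * g" and k: "k = l * g"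
      using \<open>e > 0\<close> by (simp_all add: that(4,5) N_def[symmetric] lc(1,2))
    have "gcd k b = g"
      using lc(3) by (simp add: b k gcd_mult_right gcd.commute coprime_iff_gcd_eq_1)
    moreover have "l * e < a * c * e"
      using that(2) unfolding N_def[symmetric] lc(1,2) by (simp only: ac_simps)
    then have "l < a * c" by simp
    then have "k < a * b" using \<open>g > 0\<close> by (simp add: b k flip: mult.assoc)
    moreover have "n = b * e" by (simp add: n lc(2) b)
    then have "b dvd n" "n div b = e" using \<open>c > 0\<close> \<open>g > 0\<close> by (simp_all add: b)
    moreover have "k div g * e = t" using \<open>g > 0\<close> by (simp add: k lc(1))
    ultimately show ?thesis by simp
  qed
  have "(\<Sum>(b, k)\<in>Sigma ?D (\<lambda>b. {..<a * b}). G (gcd k b) (k div gcd k b * (n div b))) =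
      (\<Sum>(g, t)\<in>Sigma ?D (\<lambda>g. {..<n div g * a}). G g t)"
    by (rule sum.reindex_bij_witness[where
          j = "\<lambda>(b, k). (gcd k b, k div gcd k b * (n div b))" and
          i = "\<lambda>(g, t). (g * (n div g div gcd t (n div g)), g * (t div gcd t (n div g)))"])
      (simp_all only: split_paired_all mem_Sigma_iff mem_Collect_eq lessThan_iff prod.case prod.inject
        fwd[OF _ _ refl refl refl] bwd[OF _ _ refl refl refl] simp_thms)
  then show ?thesis using \<open>finite ?D\<close> by (simp add: sum.Sigma)
qed

theorem theorem11:
  fixes n a d :: nat and as :: "nat \<Rightarrow> nat"
    and f :: "nat \<Rightarrow> real \<Rightarrow> complex" and m :: "nat \<Rightarrow> complex"
  assumes "n > 0" and "a > 0" and "d > 0"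
    and "\<And>j. j \<in> {1..d} \<Longrightarrow> as j > 0"
    and "dedekind_type d f m"
  shows "(\<Sum>b | b dvd n. of_nat b powr (- (\<Sum>j=1..d. m j)) *
            (\<Sum>r \<in> {1..d} \<rightarrow>\<^sub>E {..<b}.
               dedekind_sum d f (a * b) (\<lambda>j. (n div b) * as j + r j * a)))
         = of_nat n * divisor_sigma (of_nat d - 1 - (\<Sum>j=1..d. m j)) n * dedekind_sum d f a as"
proof -
  define M where "M = (\<Sum>j=1..d. m j)"
  define F where "F t = (\<Prod>j=1..d. f j (real (t * as j) / real a))" for t
  have periodic: "f j (x + 1) = f j x" if "j \<in> {1..d}" for j x
    using assms(5) that by (auto simp: dedekind_type_def)
  have distrib: "(\<Sum>k<c. f j (x + real k / real c)) = of_nat c powr m j * f j (real c * x)"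
    if "j \<in> {1..d}" "c > 0" for j x c
    using assms(5) that by (auto simp: dedekind_type_def)
  have F_periodic: "F (t + a) = F t" for t
    unfolding F_def
  proof (rule prod.cong)
    fix j assume j: "j \<in> {1..d}"
    \<comment> \<open>Replacing \<open>t\<close> by \<open>t + a\<close> moves the argument of
      \<open>f j\<close> by the integer \<open>as j\<close>.\<close>
    have shift: "f j (x + real i) = f j x" for x i
    proof (induction i)
      case (Suc i)
      then show ?case using periodic[OF j, of "x + real i"] by (simp add: algebra_simps)
    qed simp
    show "f j (real ((t + a) * as j) / real a) = f j (real (t * as j) / real a)"
      using shift[of "real (t * as j) / real a" "as j"] \<open>a > 0\<close> by (simp add: field_simps)
  qed simp
  have inner: "of_nat b powr (- M) * (\<Sum>r \<in> {1..d} \<rightarrow>\<^sub>E {..<b}.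
        \<Prod>j=1..d. f j (real (k * ((n div b) * as j + r j * a)) / real (a * b))) =
      of_nat (gcd k b) powr (of_nat d - M) * F (k div gcd k b * (n div b))"
    if "b dvd n" for b k
  proof -
    define g where "g = gcd k b"
    define c where "c = b div g"
    define l where "l = k div g"
    define e where "e = n div b"
    have "b > 0" using \<open>n > 0\<close> that by (auto intro: gr0I)
    then have g: "g > 0" "b = g * c" "k = g * l"
      by (auto simp: g_def c_def l_def)
    then have "c > 0" using \<open>b > 0\<close> by (auto intro: gr0I)
    have factor: "(\<Sum>i<b. f j (real (k * (e * as j + i * a)) / real (a * b))) =
        (of_nat g * of_nat c powr m j) * f j (real (l * e * as j) / real a)"
      if j: "j \<in> {1..d}" for j
    proof -
      \<comment> \<open>The part of the argument independent of \<open>i\<close>; the rest is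
        \<open>k * i / b\<close>, since \<open>a\<close> cancels.\<close>
      define x where "x = real (k * e * as j) / real (a * b)"
      have "(\<Sum>i<b. f j (real (k * (e * as j + i * a)) / real (a * b))) =
          (\<Sum>i<b. f j (x + real (k * i) / real b))"
        using \<open>a > 0\<close> \<open>b > 0\<close> by (intro sum.cong) (auto simp: x_def field_simps)
      also have "\<dots> = of_nat g * (\<Sum>i<c. f j (x + real i / real c))"
        unfolding g_def c_def using periodic[OF j] \<open>b > 0\<close> by (rule sum_periodic_multiples)
      also have "\<dots> = of_nat g * (of_nat c powr m j * f j (real c * x))"
        using distrib[OF j \<open>c > 0\<close>] by simp
      also have "real c * x = real (l * e * as j) / real a"
        using \<open>c > 0\<close> \<open>g > 0\<close> by (simp add: x_def g(2,3))
      finally show ?thesis by (simp add: mult.assoc)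
    qed
    \<comment> \<open>The \<open>j\<close>-th factor involves only the coordinate
      \<open>r j\<close>, so the sum over tuples is a product of single sums.\<close>
    have "(\<Sum>r \<in> {1..d} \<rightarrow>\<^sub>E {..<b}. \<Prod>j=1..d. f j (real (k * (e * as j + r j * a)) / real (a * b))) =
        (\<Prod>j=1..d. \<Sum>i<b. f j (real (k * (e * as j + i * a)) / real (a * b)))"
      by (rule prod_sum_PiE[symmetric]) auto
    also have "\<dots> = (\<Prod>j=1..d. of_nat g * of_nat c powr m j) * F (l * e)"
      unfolding F_def prod.distrib[symmetric] using factor by (intro prod.cong) auto
    finally have "(\<Sum>r \<in> {1..d} \<rightarrow>\<^sub>E {..<b}.
          \<Prod>j=1..d. f j (real (k * (e * as j + r j * a)) / real (a * b))) =
        (\<Prod>j=1..d. of_nat g * of_nat c powr m j) * F (l * e)" .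
    moreover have "of_nat b powr (- M) * (\<Prod>j=1..d. of_nat g * of_nat c powr m j) =
        of_nat g powr (of_nat d - M)"
      using prod_powr_weights[of "{1..d}" g c m] \<open>c > 0\<close> g(1) unfolding M_def g(2) by simp
    ultimately show ?thesis
      unfolding g_def[symmetric] l_def[symmetric] e_def[symmetric] by (metis mult.assoc)
  qed
  have "(\<Sum>b | b dvd n. of_nat b powr (- M) *
          (\<Sum>r \<in> {1..d} \<rightarrow>\<^sub>E {..<b}. dedekind_sum d f (a * b) (\<lambda>j. (n div b) * as j + r j * a))) =
      (\<Sum>b | b dvd n. \<Sum>k<a * b.
          of_nat (gcd k b) powr (of_nat d - M) * F (k div gcd k b * (n div b)))"
  proof (rule sum.cong)
    fix b assume "b \<in> {b. b dvd n}"
    then have "b dvd n" by simp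
    show "of_nat b powr (- M) * (\<Sum>r \<in> {1..d} \<rightarrow>\<^sub>E {..<b}.
            dedekind_sum d f (a * b) (\<lambda>j. (n div b) * as j + r j * a)) =
        (\<Sum>k<a * b. of_nat (gcd k b) powr (of_nat d - M) * F (k div gcd k b * (n div b)))"
      \<comment> \<open>With \<open>inner\<close> read from right to left, only the order of
        summation over \<open>r\<close> and \<open>k\<close> differs.\<close>
      unfolding dedekind_sum_def inner[OF \<open>b dvd n\<close>, symmetric] sum_distrib_left[symmetric]
      by (subst sum.swap) (rule refl)
  qed simp
  also have "\<dots> = (\<Sum>g | g dvd n. \<Sum>t<n div g * a. of_nat g powr (of_nat d - M) * F t)"
    using \<open>n > 0\<close> by (rule sum_gcd_reindex)
  also have "\<dots> = (\<Sum>g | g dvd n. of_nat g powr (of_nat d - M) * (of_nat (n div g) * (\<Sum>t<a. F t)))"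
    by (simp add: sum_distrib_left[symmetric] sum_periodic_periods[of F a, OF F_periodic])
  also have "\<dots> = (\<Sum>g | g dvd n. of_nat n * of_nat g powr (of_nat d - 1 - M) * (\<Sum>t<a. F t))"
  proof (rule sum.cong)
    fix g assume "g \<in> {g. g dvd n}"
    \<comment> \<open>Writing \<open>n div g\<close> as \<open>n\<close> times the inverse of
      \<open>g\<close> lowers the exponent of \<open>g\<close> by one, which is the
      \<open>- 1\<close> in the index of the divisor function.\<close>
    then have "g > 0" "(of_nat n :: complex) = of_nat g * of_nat (n div g)"
      using \<open>n > 0\<close> by (auto intro: gr0I simp flip: of_nat_mult)
    then show "of_nat g powr (of_nat d - M) * (of_nat (n div g) * (\<Sum>t<a. F t)) =
        of_nat n * of_nat g powr (of_nat d - 1 - M) * (\<Sum>t<a. F t)"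
      by (simp add: powr_diff)
  qed simp
  also have "\<dots> = of_nat n * divisor_sigma (of_nat d - 1 - M) n * dedekind_sum d f a as"
    by (simp only: divisor_sigma_def dedekind_sum_def F_def flip: sum_distrib_left sum_distrib_right)
  finally show ?thesis unfolding M_def .
qed

end
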